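(* Let $\sigma \geq p/2$. Then the scheme $$\frac{y^{n+1} - y^n}{\tau} + \sum_{\alpha = 1}^{p} (I+\sigma \tau R_\alpha A)^{-1} R_\alpha A y^n = 0, \quad n=0,1,\ldots,N-1, \qquad y^0=u^0,$$ is unconditionally stable in $H_A$ (i.e. stable with no restriction on the time step $\tau>0$), and its solution satisfies the estimate of stability with respect to the initial data $$\|y^{n+1}\|_A \leq \| u^0 \|_A, \quad n = 0,1, \ldots, N-1 .$$
   Context: $H$ is a finite-dimensional Hilbert space with scalar product $(u,v)$; $I$ is the identity operator on $H$. $A: H\to H$ is a constant linear operator which is self-adjoint and positive, $A=A^*>0$ (i.e. $(Au,u)>0$ for $u\ne 0$), and $\|u\|_A=(Au,u)^{1/2}$ is the norm of the space $H_A$. The operators $R_\alpha:H\to H$, $\alpha=1,2,\ldots,p$, are linear and give an additive decomposition of the identity: $I=\sum_{\alpha=1}^p R_\alpha$, with $R_\alpha=R_\alpha^*\ge 0$ (self-adjoint, $(R_\alpha u,u)\ge 0$ for all $u$), $\alpha=1,\ldots,p$. Here $u^0\in H$ is given, $\tau>0$ is the time step with $N\tau=T$, and $\sigma$ is a constant (the scheme approximates the homogeneous Cauchy problem $\frac{du}{dt}+\sum_{\alpha=1}^p R_\alpha A u=0$, $u(0)=u^0$). *)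

theory Defs
  imports "HOL-Analysis.Analysis"
begin

definition norm_in :: "('a::euclidean_space \<Rightarrow> 'a) \<Rightarrow> 'a \<Rightarrow> real" where
  "norm_in A u = sqrt (A u \<bullet> u)"

definition implicit_factor ::
  "('a::euclidean_space \<Rightarrow> 'a) \<Rightarrow> (nat \<Rightarrow> 'a \<Rightarrow> 'a) \<Rightarrow> real \<Rightarrow> real \<Rightarrow> nat \<Rightarrow> 'a \<Rightarrow> 'a" where
  "implicit_factor A R \<sigma> \<tau> \<alpha> u = u + (\<sigma> * \<tau>) *\<^sub>R R \<alpha> (A u)"

text \<open>
  The inverse operators are rendered by \<^const>\<open>inv\<close>, which is meaningful only where
  \<^term>\<open>implicit_factor A R \<sigma> \<tau> \<alpha>\<close> is bijective; the bijectivity is therefore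
  to be asserted along with any claim about the scheme.
\<close>

definition scheme_solution ::
  "('a::euclidean_space \<Rightarrow> 'a) \<Rightarrow> nat \<Rightarrow> (nat \<Rightarrow> 'a \<Rightarrow> 'a) \<Rightarrow> real \<Rightarrow> real \<Rightarrow> nat \<Rightarrow> 'a
    \<Rightarrow> (nat \<Rightarrow> 'a) \<Rightarrow> bool" where
  "scheme_solution A p R \<sigma> \<tau> N u0 y \<longleftrightarrow>
     y 0 = u0 \<and>
     (\<forall>n<N. (y (n + 1) - y n) /\<^sub>R \<tau>
        + (\<Sum>\<alpha>=1..p. inv (implicit_factor A R \<sigma> \<tau> \<alpha>) (R \<alpha> (A (y n)))) = 0)"

text \<open>
  Stability with respect to the initial data on the time interval from 0 to \<open>T\<close>: the
  constant \<open>M\<close> depends neither on the initial data nor on the grid.  It is unconditional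
  because every time step \<open>\<tau> > 0\<close> dividing the interval into \<open>N\<close> equal parts is admitted.
\<close>

definition unconditionally_stable ::
  "('a::euclidean_space \<Rightarrow> 'a) \<Rightarrow> nat \<Rightarrow> (nat \<Rightarrow> 'a \<Rightarrow> 'a) \<Rightarrow> real \<Rightarrow> real \<Rightarrow> bool" where
  "unconditionally_stable A p R \<sigma> T \<longleftrightarrow>
     (\<exists>M. \<forall>\<tau>>0. \<forall>N. real N * \<tau> = T \<longrightarrow>
        (\<forall>u0 y. scheme_solution A p R \<sigma> \<tau> N u0 y \<longrightarrow>
           (\<forall>n<N. norm_in A (y (n + 1)) \<le> M * norm_in A u0)))"

end

theory Submission
  imports Defs
begin

text \<open>
  Everything is an energy argument in the form \<open>(A u, v)\<close>.  Let
  \<open>w\<^sub>\<alpha> = (I + \<sigma>\<tau>R\<^sub>\<alpha>A)\<^sup>-\<^sup>1 R\<^sub>\<alpha>A y\<close>, so that one step of the scheme is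
  \<open>y \<mapsto> y - \<tau> \<Sum>\<^sub>\<alpha> w\<^sub>\<alpha>\<close>.  Since \<open>w\<^sub>\<alpha> = R\<^sub>\<alpha>A (y - \<sigma>\<tau>w\<^sub>\<alpha>)\<close> and
  \<open>R\<^sub>\<alpha> \<ge> 0\<close>, pairing \<open>w\<^sub>\<alpha>\<close> with \<open>A (y - \<sigma>\<tau>w\<^sub>\<alpha>)\<close> gives
  \<open>(A y, w\<^sub>\<alpha>) \<ge> \<sigma>\<tau> (A w\<^sub>\<alpha>, w\<^sub>\<alpha>)\<close>: each component dissipates energy
  (\<open>resolvent_dissipation\<close>).  Expanding the square,
  \<open>\<parallel>y - \<tau> \<Sum> w\<^sub>\<alpha>\<parallel>\<^sub>A\<^sup>2 = \<parallel>y\<parallel>\<^sub>A\<^sup>2 - 2\<tau> \<Sum> (A y, w\<^sub>\<alpha>) + \<tau>\<^sup>2 \<parallel>\<Sum> w\<^sub>\<alpha>\<parallel>\<^sub>A\<^sup>2\<close>,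
  the last term is at most \<open>p \<tau>\<^sup>2 \<Sum> \<parallel>w\<^sub>\<alpha>\<parallel>\<^sub>A\<^sup>2\<close> by the Cauchy--Schwarz inequality
  (\<open>quadratic_form_sum_le\<close>), while the middle one removes at least
  \<open>2\<sigma> \<tau>\<^sup>2 \<Sum> \<parallel>w\<^sub>\<alpha>\<parallel>\<^sub>A\<^sup>2\<close>.  The balance is nonpositive as soon as \<open>2\<sigma> \<ge> p\<close>,
  whatever \<open>\<tau>\<close> is, so the \<open>A\<close>-norm does not grow from one level to the next.
\<close>

lemma selfadjoint_inner_commute:
  fixes A :: "'a::euclidean_space \<Rightarrow> 'a"
  assumes "linear A" and "adjoint A = A"
  shows "A u \<bullet> v = A v \<bullet> u"
  using adjoint_works[OF assms(1), of u v] assms(2) by (simp add: inner_commute)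

text \<open>
  The Cauchy--Schwarz inequality in the form \<open>\<parallel>\<Sum> w\<^sub>i\<parallel>\<^sup>2 \<le> |I| \<Sum> \<parallel>w\<^sub>i\<parallel>\<^sup>2\<close>, for the seminorm
  of \<open>A\<close>: the difference of the two sides is, up to the factor \<open>|I|\<close>, the sum of squared
  deviations of the \<open>w\<^sub>i\<close> from their mean.
\<close>
lemma quadratic_form_sum_le:
  fixes A :: "'a::euclidean_space \<Rightarrow> 'a" and w :: "'i \<Rightarrow> 'a"
  assumes A: "linear A" "adjoint A = A" and nonneg: "\<And>u. 0 \<le> A u \<bullet> u"
  shows "A (\<Sum>i\<in>I. w i) \<bullet> (\<Sum>i\<in>I. w i) \<le> real (card I) * (\<Sum>i\<in>I. A (w i) \<bullet> w i)"
proof (cases "card I = 0")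
  case True
  then show ?thesis by (auto simp: card_eq_0_iff linear_0[OF A(1)])
next
  case False
  define S k Q where "S = (\<Sum>i\<in>I. w i)" and "k = real (card I)"
    and "Q = (\<Sum>i\<in>I. A (w i) \<bullet> w i)"
  have k: "k > 0" using False by (simp add: k_def)
  \<comment> \<open>Deviations from the mean \<open>S / k\<close>, scaled by \<open>k\<close> to avoid division.\<close>
  have dev: "A (k *\<^sub>R w i - S) \<bullet> (k *\<^sub>R w i - S)
      = k\<^sup>2 * (A (w i) \<bullet> w i) - 2 * k * (A S \<bullet> w i) + A S \<bullet> S" for i
    using selfadjoint_inner_commute[OF A, of "w i" S]
    by (simp add: linear_diff[OF A(1)] linear_scale[OF A(1)] inner_diff power2_eq_square
        algebra_simps)
  have "0 \<le> (\<Sum>i\<in>I. A (k *\<^sub>R w i - S) \<bullet> (k *\<^sub>R w i - S))"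
    by (intro sum_nonneg nonneg)
  also have "\<dots> = k\<^sup>2 * Q - 2 * k * (A S \<bullet> S) + k * (A S \<bullet> S)"
    unfolding dev by (simp add: sum.distrib sum_subtractf Q_def k_def
        flip: sum_distrib_left inner_sum_right S_def)
  also have "\<dots> = k * (k * Q - A S \<bullet> S)"
    by (simp add: algebra_simps power2_eq_square)
  finally show ?thesis
    using k by (simp add: zero_le_mult_iff S_def k_def Q_def)
qed

text \<open>
  If \<open>u + \<sigma>\<tau>R\<^sub>\<alpha>A u = 0\<close>, pairing with \<open>A u\<close> makes a sum of two nonnegative terms vanish, the
  first being \<open>(A u, u)\<close>; hence the factor is injective, and in finite dimension bijective.
\<close>
lemma bij_implicit_factor:
  fixes A :: "'a::euclidean_space \<Rightarrow> 'a"
  assumes A: "linear A" "\<And>u. u \<noteq> 0 \<Longrightarrow> A u \<bullet> u > 0"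
    and R: "linear (R \<alpha>)" "\<And>u. R \<alpha> u \<bullet> u \<ge> 0"
    and "\<sigma> * \<tau> \<ge> 0"
  shows "bij (implicit_factor A R \<sigma> \<tau> \<alpha>)"
proof -
  let ?F = "implicit_factor A R \<sigma> \<tau> \<alpha>"
  have lin: "linear ?F"
    unfolding implicit_factor_def
    by (intro linear_compose_add linear_ident linear_compose_scale_right
        linear_compose[OF A(1) R(1), unfolded o_def])
  have "u = 0" if "?F u = 0" for u
  proof (rule ccontr)
    assume "u \<noteq> 0"
    then have "0 < A u \<bullet> u + \<sigma> * \<tau> * (R \<alpha> (A u) \<bullet> A u)"
      using A(2) R(2) \<open>\<sigma> * \<tau> \<ge> 0\<close> by (simp add: add_pos_nonneg)
    also have "\<dots> = ?F u \<bullet> A u"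
      by (simp add: implicit_factor_def inner_add_left inner_commute[of u])
    finally show False using that by simp
  qed
  then have "inj ?F" using linear_injective_0[OF lin] by blast
  then show ?thesis
    using linear_injective_imp_surjective[OF lin] by (simp add: bij_def)
qed

text \<open>
  Rewriting \<open>w + c B (A w) = B (A y)\<close> as \<open>w = B (A z)\<close> with \<open>z = y - c w\<close>, nonnegativity of \<open>B\<close>
  gives \<open>(A z, w) \<ge> 0\<close>.  This is the source of the dissipation, and it is the implicitness
  parameter \<open>c = \<sigma>\<tau>\<close> that measures it.
\<close>
lemma resolvent_dissipation:
  fixes A B :: "'a::euclidean_space \<Rightarrow> 'a"
  assumes "linear A" "linear B" "\<And>u. B u \<bullet> u \<ge> 0"
    and eq: "w + c *\<^sub>R B (A w) = B (A y)"
  shows "c * (A w \<bullet> w) \<le> A y \<bullet> w"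
proof -
  define z where "z = y - c *\<^sub>R w"
  have Az: "A z = A y - c *\<^sub>R A w"
    by (simp add: z_def linear_diff[OF assms(1)] linear_scale[OF assms(1)])
  have "w = B (A z)"
    unfolding Az using eq
    by (simp add: linear_diff[OF assms(2)] linear_scale[OF assms(2)] algebra_simps)
  then have "0 \<le> A z \<bullet> w"
    using assms(3)[of "A z"] by (simp add: inner_commute)
  then show ?thesis by (simp add: Az inner_diff_left)
qed

text \<open>
  The energy balance of one step, isolated from the way the corrections \<open>w\<^sub>i\<close> are produced:
  Cauchy--Schwarz costs a factor \<open>|I|\<close>, which the dissipation with weight \<open>2\<sigma>\<close> has to pay for.
\<close>
lemma norm_in_dissipative_step:
  fixes A :: "'a::euclidean_space \<Rightarrow> 'a" and w :: "'i \<Rightarrow> 'a"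
  assumes A: "linear A" "adjoint A = A" and nonneg: "\<And>u. 0 \<le> A u \<bullet> u"
    and "\<tau> \<ge> 0" and \<sigma>: "\<sigma> \<ge> real (card I) / 2"
    and diss: "\<And>i. i \<in> I \<Longrightarrow> \<sigma> * \<tau> * (A (w i) \<bullet> w i) \<le> A y \<bullet> w i"
  shows "norm_in A (y - \<tau> *\<^sub>R (\<Sum>i\<in>I. w i)) \<le> norm_in A y"
proof -
  define S Q where "S = (\<Sum>i\<in>I. w i)" and "Q = (\<Sum>i\<in>I. A (w i) \<bullet> w i)"
  have Q: "Q \<ge> 0" unfolding Q_def by (intro sum_nonneg nonneg)
  have CS: "A S \<bullet> S \<le> real (card I) * Q"
    unfolding S_def Q_def by (rule quadratic_form_sum_le[OF A nonneg])
  have "real (card I) * Q \<le> 2 * \<sigma> * Q"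
    using \<sigma> Q by (intro mult_right_mono) auto
  with CS have "\<tau>\<^sup>2 * (A S \<bullet> S) \<le> \<tau>\<^sup>2 * (2 * \<sigma> * Q)"
    by (intro mult_left_mono) auto
  moreover have "\<sigma> * \<tau> * Q \<le> A y \<bullet> S"
    unfolding S_def Q_def inner_sum_right sum_distrib_left by (intro sum_mono diss)
  then have "2 * \<tau> * (\<sigma> * \<tau> * Q) \<le> 2 * \<tau> * (A y \<bullet> S)"
    using \<open>\<tau> \<ge> 0\<close> by (intro mult_left_mono) auto
  moreover have "A (y - \<tau> *\<^sub>R S) \<bullet> (y - \<tau> *\<^sub>R S)
      = A y \<bullet> y - 2 * \<tau> * (A y \<bullet> S) + \<tau>\<^sup>2 * (A S \<bullet> S)"
    using selfadjoint_inner_commute[OF A, of S y]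
    by (simp add: linear_diff[OF A(1)] linear_scale[OF A(1)] inner_diff power2_eq_square
        algebra_simps)
  ultimately have "A (y - \<tau> *\<^sub>R S) \<bullet> (y - \<tau> *\<^sub>R S) \<le> A y \<bullet> y"
    by (simp add: power2_eq_square algebra_simps)
  then show ?thesis by (simp add: norm_in_def S_def)
qed

theorem theorem2:
  fixes A :: "'a::euclidean_space \<Rightarrow> 'a"
    and R :: "nat \<Rightarrow> 'a \<Rightarrow> 'a"
    and p :: nat
    and \<sigma> T :: real
  assumes "linear A" and "adjoint A = A" and "\<And>u. u \<noteq> 0 \<Longrightarrow> A u \<bullet> u > 0"
    and "\<And>\<alpha>. \<alpha> \<in> {1..p} \<Longrightarrow> linear (R \<alpha>)"
    and "\<And>\<alpha>. \<alpha> \<in> {1..p} \<Longrightarrow> adjoint (R \<alpha>) = R \<alpha>"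
    and "\<And>\<alpha> u. \<alpha> \<in> {1..p} \<Longrightarrow> R \<alpha> u \<bullet> u \<ge> 0"
    and "\<And>u. (\<Sum>\<alpha>=1..p. R \<alpha> u) = u"
    and "\<sigma> \<ge> real p / 2"
  shows "(\<forall>\<tau>>0. \<forall>\<alpha>\<in>{1..p}. bij (implicit_factor A R \<sigma> \<tau> \<alpha>))
    \<and> unconditionally_stable A p R \<sigma> T
    \<and> (\<forall>\<tau>>0. \<forall>N u0 y. real N * \<tau> = T \<longrightarrow> scheme_solution A p R \<sigma> \<tau> N u0 y \<longrightarrow>
         (\<forall>n<N. norm_in A (y (n + 1)) \<le> norm_in A u0))"
proof -
  have \<sigma>: "\<sigma> \<ge> 0"
    by (rule order_trans[OF _ assms(8)]) simp
  have nonneg: "0 \<le> A u \<bullet> u" for u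
    using assms(3)[of u] linear_0[OF assms(1)] by (cases "u = 0") auto
  have bij: "bij (implicit_factor A R \<sigma> \<tau> \<alpha>)" if "\<tau> > 0" "\<alpha> \<in> {1..p}" for \<tau> \<alpha>
    using that \<sigma> by (intro bij_implicit_factor assms(1,3,4,6)) auto
  have estimate: "norm_in A (y (n + 1)) \<le> norm_in A u0"
    if "\<tau> > 0" "scheme_solution A p R \<sigma> \<tau> N u0 y" "n < N" for \<tau> N u0 y n
  proof -
    have y0: "y 0 = u0"
      and scheme: "\<And>m. m < N \<Longrightarrow> (y (m + 1) - y m) /\<^sub>R \<tau>
        + (\<Sum>\<alpha>=1..p. inv (implicit_factor A R \<sigma> \<tau> \<alpha>) (R \<alpha> (A (y m)))) = 0"
      using that(2) by (auto simp: scheme_solution_def)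
    have step: "norm_in A (y (m + 1)) \<le> norm_in A (y m)" if "m < N" for m
    proof -
      define w where "w = (\<lambda>\<alpha>. inv (implicit_factor A R \<sigma> \<tau> \<alpha>) (R \<alpha> (A (y m))))"
      have "(y (m + 1) - y m) /\<^sub>R \<tau> = - (\<Sum>\<alpha>=1..p. w \<alpha>)"
        using scheme[OF that] by (simp add: w_def eq_neg_iff_add_eq_0)
      then have "\<tau> *\<^sub>R ((y (m + 1) - y m) /\<^sub>R \<tau>) = \<tau> *\<^sub>R (- (\<Sum>\<alpha>=1..p. w \<alpha>))"
        by (rule arg_cong)
      then have next_level: "y (m + 1) = y m - \<tau> *\<^sub>R (\<Sum>\<alpha>=1..p. w \<alpha>)"
        using \<open>\<tau> > 0\<close> by (simp add: algebra_simps)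
      have "\<sigma> * \<tau> * (A (w \<alpha>) \<bullet> w \<alpha>) \<le> A (y m) \<bullet> w \<alpha>" if "\<alpha> \<in> {1..p}" for \<alpha>
      proof (rule resolvent_dissipation[OF assms(1,4,6)])
        have "implicit_factor A R \<sigma> \<tau> \<alpha> (w \<alpha>) = R \<alpha> (A (y m))"
          unfolding w_def using bij[OF \<open>\<tau> > 0\<close> that] by (simp add: bij_is_surj surj_f_inv_f)
        then show "w \<alpha> + (\<sigma> * \<tau>) *\<^sub>R R \<alpha> (A (w \<alpha>)) = R \<alpha> (A (y m))"
          by (simp add: implicit_factor_def)
      qed (use that in auto)
      then show ?thesis
        unfolding next_level
        using \<open>\<tau> > 0\<close> assms(8) by (intro norm_in_dissipative_step[OF assms(1,2) nonneg]) auto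
    qed
    have "norm_in A (y m) \<le> norm_in A u0" if "m \<le> N" for m
      using that
    proof (induction m)
      case (Suc m)
      then show ?case using step[of m] by simp
    qed (simp add: y0)
    then show ?thesis using \<open>n < N\<close> by simp
  qed
  \<comment> \<open>The estimate is stability with the constant \<open>M = 1\<close>.\<close>
  have "unconditionally_stable A p R \<sigma> T"
    unfolding unconditionally_stable_def by (intro exI[of _ 1]) (simp add: estimate[simplified])
  then show ?thesis using bij estimate by blast
qed

end
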